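(* Let $U_1=\{L(\alpha)\in CE(\mu_4): b_{1,1}\neq 0,\ b_{1,2}\neq 0\}$, and for $\alpha=(b_{0,0},b_{0,1},b_{1,1},b_{1,2})$ put $\Delta=b_{0,1}^2-4b_{0,0}b_{1,1}$ (and $\Delta'=b_{0,1}'^2-4b_{0,0}'b_{1,1}'$ for $\alpha'$). (1) Two algebras $L(\alpha)$ and $L(\alpha')$ from $U_1$ are isomorphic if and only if $$\left(\frac{b_{1,2}}{b_{1,1}}\right)^4\Delta=\left(\frac{b_{1,2}'}{b_{1,1}'}\right)^4\Delta'.$$ (2) For any $\lambda\in\mathbb{C}$ there exists $L(\alpha)\in U_1$ with $\left(\frac{b_{1,2}}{b_{1,1}}\right)^4\Delta=\lambda$. Then the algebras from $U_1$ can be parameterized as $L(\lambda,0,1,1)$, $\lambda\in\mathbb{C}$; that is, every algebra in $U_1$ is isomorphic to $L(\lambda,0,1,1)$ for some $\lambda\in\mathbb{C}$.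
   Context: A Leibniz algebra over $\mathbb{C}$ is a complex vector space with a bilinear bracket satisfying $[x,[y,z]]=[[x,y],z]-[[x,z],y]$. $CE(\mu_4)$ (one-dimensional Leibniz central extensions of the 4-dimensional naturally graded filiform Lie algebra $\mu_4$) is the class of the 5-dimensional complex Leibniz algebras $L(\alpha)$, $\alpha=(b_{0,0},b_{0,1},b_{1,1},b_{1,2})\in\mathbb{C}^4$, with basis $e_0,\dots,e_4$ and brackets $[e_i,e_0]=e_{i+1}$ ($1\le i\le 3$), $[e_0,e_i]=-e_{i+1}$ ($2\le i\le 3$), $[e_0,e_0]=b_{0,0}e_4$, $[e_0,e_1]=-e_2+b_{0,1}e_4$, $[e_1,e_1]=b_{1,1}e_4$, $[e_1,e_2]=-[e_2,e_1]=b_{1,2}e_4$, all other brackets of basis vectors being zero. Isomorphic means isomorphic as Leibniz algebras. *)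

theory Defs
  imports "HOL-Analysis.Analysis"
begin

locale leibniz_algebra = vector_space smul
  for smul :: "complex \<Rightarrow> 'a::ab_group_add \<Rightarrow> 'a" +
  fixes bracket :: "'a \<Rightarrow> 'a \<Rightarrow> 'a"
  assumes linear_bracket_left: "Vector_Spaces.linear smul smul (\<lambda>x. bracket x y)"
    and linear_bracket_right: "Vector_Spaces.linear smul smul (bracket x)"
    and leibniz: "bracket x (bracket y z) = bracket (bracket x y) z - bracket (bracket x z) y"

definition leibniz_isomorphic ::
  "(complex \<Rightarrow> 'a::ab_group_add \<Rightarrow> 'a) \<Rightarrow> ('a \<Rightarrow> 'a \<Rightarrow> 'a) \<Rightarrow>
   (complex \<Rightarrow> 'b::ab_group_add \<Rightarrow> 'b) \<Rightarrow> ('b \<Rightarrow> 'b \<Rightarrow> 'b) \<Rightarrow> bool" where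
  "leibniz_isomorphic smul bracket smul' bracket' \<longleftrightarrow>
     leibniz_algebra smul bracket \<and> leibniz_algebra smul' bracket' \<and>
     (\<exists>f. Vector_Spaces.linear smul smul' f \<and> bij f \<and>
          (\<forall>x y. f (bracket x y) = bracket' (f x) (f y)))"

text \<open>The algebras live on \<^typ>\<open>complex ^ 5\<close>, with complex scalar multiplication \<open>(*s)\<close>.
  The basis vectors are indexed by the elements 0, ..., 4 of the type \<^typ>\<open>5\<close>
  (integers modulo 5; no index below wraps around).\<close>

definition e :: "5 \<Rightarrow> complex ^ 5" where
  "e i = axis i 1"

definition basis_bracket ::
  "complex \<Rightarrow> complex \<Rightarrow> complex \<Rightarrow> complex \<Rightarrow> 5 \<Rightarrow> 5 \<Rightarrow> complex ^ 5" where
  "basis_bracket b00 b01 b11 b12 i j =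
     (if i \<in> {1, 2, 3} \<and> j = 0 then e (i + 1)
      else if i = 0 \<and> j \<in> {2, 3} then - e (j + 1)
      else if i = 0 \<and> j = 0 then b00 *s e 4
      else if i = 0 \<and> j = 1 then - e 2 + b01 *s e 4
      else if i = 1 \<and> j = 1 then b11 *s e 4
      else if i = 1 \<and> j = 2 then b12 *s e 4
      else if i = 2 \<and> j = 1 then - (b12 *s e 4)
      else 0)"

definition L ::
  "complex \<Rightarrow> complex \<Rightarrow> complex \<Rightarrow> complex \<Rightarrow> complex ^ 5 \<Rightarrow> complex ^ 5 \<Rightarrow> complex ^ 5" where
  "L b00 b01 b11 b12 x y =
     (\<Sum>i\<in>UNIV. \<Sum>j\<in>UNIV. (x $ i * y $ j) *s basis_bracket b00 b01 b11 b12 i j)"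

definition isomorphic ::
  "(complex ^ 5 \<Rightarrow> complex ^ 5 \<Rightarrow> complex ^ 5) \<Rightarrow> (complex ^ 5 \<Rightarrow> complex ^ 5 \<Rightarrow> complex ^ 5) \<Rightarrow> bool"
  where "isomorphic A B \<longleftrightarrow> leibniz_isomorphic (*s) A (*s) B"

definition CE_mu4 :: "(complex ^ 5 \<Rightarrow> complex ^ 5 \<Rightarrow> complex ^ 5) set" where
  "CE_mu4 = {L b00 b01 b11 b12 | b00 b01 b11 b12. True}"

definition U1 :: "(complex ^ 5 \<Rightarrow> complex ^ 5 \<Rightarrow> complex ^ 5) set" where
  "U1 = {L b00 b01 b11 b12 | b00 b01 b11 b12.
           L b00 b01 b11 b12 \<in> CE_mu4 \<and> b11 \<noteq> 0 \<and> b12 \<noteq> 0}"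

definition Delta :: "complex \<Rightarrow> complex \<Rightarrow> complex \<Rightarrow> complex" where
  "Delta b00 b01 b11 = b01\<^sup>2 - 4 * b00 * b11"

lemma UNIV_5: "(UNIV :: 5 set) = {0, 1, 2, 3, 4}"
proof -
  have "card {0, 1, 2, 3, 4 :: 5} = CARD(5)" by simp
  then show ?thesis by (intro card_subset_eq[symmetric]) simp_all
qed

lemma forall_5: "(\<forall>i::5. P i) \<longleftrightarrow> P 0 \<and> P 1 \<and> P 2 \<and> P 3 \<and> P 4"
  using ball_UNIV[of P] unfolding UNIV_5 by simp

lemma sum_5:
  fixes f :: "5 \<Rightarrow> 'b::comm_monoid_add"
  shows "(\<Sum>i\<in>UNIV. f i) = f 0 + f 1 + f 2 + f 3 + f 4"
  unfolding UNIV_5 by (simp add: add.assoc)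

lemma e_nth: "e i $ j = (if j = i then 1 else 0)"
  by (simp add: e_def axis_def)

lemma L_basis: "L b00 b01 b11 b12 (e i) (e j) = basis_bracket b00 b01 b11 b12 i j"
proof -
  have "L b00 b01 b11 b12 (e i) (e j) =
    (\<Sum>k\<in>UNIV. \<Sum>l\<in>UNIV. if k = i then if l = j then basis_bracket b00 b01 b11 b12 k l else 0 else 0)"
    unfolding L_def by (intro sum.cong refl) (simp add: e_nth)
  also have "\<dots> = (\<Sum>k\<in>UNIV. if k = i then basis_bracket b00 b01 b11 b12 k j else 0)"
    by (intro sum.cong refl) simp
  also have "\<dots> = basis_bracket b00 b01 b11 b12 i j"
    by simp
  finally show ?thesis .
qed

lemma L_coordinates:
  "L b00 b01 b11 b12 x y $ 0 = 0"
  "L b00 b01 b11 b12 x y $ 1 = 0"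
  "L b00 b01 b11 b12 x y $ 2 = x $ 1 * y $ 0 - x $ 0 * y $ 1"
  "L b00 b01 b11 b12 x y $ 3 = x $ 2 * y $ 0 - x $ 0 * y $ 2"
  "L b00 b01 b11 b12 x y $ 4 = x $ 3 * y $ 0 - x $ 0 * y $ 3 + b00 * x $ 0 * y $ 0
     + b01 * x $ 0 * y $ 1 + b11 * x $ 1 * y $ 1 + b12 * (x $ 1 * y $ 2 - x $ 2 * y $ 1)"
  unfolding L_def sum_5 by (simp_all add: basis_bracket_def e_nth algebra_simps)

lemma leibniz_algebra_L: "leibniz_algebra (*s) (L b00 b01 b11 b12)"
  by unfold_locales
    (simp_all add: vec_eq_iff forall_5 L_coordinates algebra_simps)

end

theory Submission
  imports Defs
begin

text \<open>An isomorphism is determined by the images of the generators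
  \<open>e\<^sub>0 \<mapsto> a\<^sub>0e\<^sub>0 + a\<^sub>1e\<^sub>1 + \<dots>\<close> and \<open>e\<^sub>1 \<mapsto> c\<^sub>0e\<^sub>0 + c\<^sub>1e\<^sub>1 + \<dots>\<close>. The bracket
  \<open>[e\<^sub>1, e\<^sub>2]\<close> forces \<open>c\<^sub>0 = 0\<close>, and comparing the \<open>e\<^sub>4\<close>-coordinates of the remaining brackets
  leaves four equations in \<open>a\<^sub>0\<close>, \<open>a\<^sub>1\<close>, \<open>c\<^sub>1\<close>; the other coefficients are irrelevant.
  Eliminating \<open>a\<^sub>1\<close> and \<open>c\<^sub>1\<close> gives \<open>\<Delta>' = a\<^sub>0\<^sup>4 \<Delta>\<close> and
  \<open>b\<^sub>1\<^sub>2 / b\<^sub>1\<^sub>1 = a\<^sub>0 b\<^sub>1\<^sub>2' / b\<^sub>1\<^sub>1'\<close>. Conversely, the second relation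
  prescribes \<open>a\<^sub>0\<close>, from which \<open>a\<^sub>1\<close> and \<open>c\<^sub>1\<close> are read off.\<close>

text \<open>The equation \<open>eqij\<close> records the \<open>e 4\<close>-coordinate of the image
  of the bracket of \<open>e i\<close> and \<open>e j\<close>, with the nonzero factors
  \<open>c1\<close> (in \<open>eq01\<close>, \<open>eq11\<close>) and \<open>a0 * c1\<close> (in
  \<open>eq12\<close>) cancelled.\<close>

locale change_of_generators =
  fixes b00 b01 b11 b12 b00' b01' b11' b12' a0 a1 c1 :: complex
  assumes a0_nz: "a0 \<noteq> 0" and c1_nz: "c1 \<noteq> 0"
    and eq00: "b00' * a0\<^sup>2 + b01' * a0 * a1 + b11' * a1\<^sup>2 = b00 * c1 * a0 ^ 3"
    and eq01: "b01' * a0 + 2 * b11' * a1 = b01 * a0 ^ 3"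
    and eq11: "b11' * c1 = b11 * a0 ^ 3"
    and eq12: "b12' * c1 = b12 * a0\<^sup>2"
begin

lemma Delta_transform: "Delta b00' b01' b11' = a0 ^ 4 * Delta b00 b01 b11"
proof -
  \<comment> \<open>Completing the square: the left side is
    \<open>(b01' * a0 + 2 * b11' * a1)\<^sup>2\<close> minus \<open>4 * b11'\<close> times the left
    side of \<open>eq00\<close>.\<close>
  have "a0\<^sup>2 * Delta b00' b01' b11' = a0\<^sup>2 * (a0 ^ 4 * Delta b00 b01 b11)"
    unfolding Delta_def using eq00 eq01 eq11 by algebra
  then show ?thesis using a0_nz by (simp only: mult_cancel_left) simp
qed

lemma ratio_transform:
  assumes "b11 \<noteq> 0" "b11' \<noteq> 0"
  shows "b12 / b11 = a0 * (b12' / b11')"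
proof -
  have "(b12 * b11') * (c1 * a0\<^sup>2) = (a0 * (b12' * b11)) * (c1 * a0\<^sup>2)"
    using eq11 eq12 by algebra
  then have "b12 * b11' = a0 * (b12' * b11)"
    using a0_nz c1_nz by simp
  then show ?thesis
    using assms by (simp add: field_simps)
qed

lemma invariant_eq:
  assumes "b11 \<noteq> 0" "b11' \<noteq> 0"
  shows "(b12 / b11) ^ 4 * Delta b00 b01 b11 = (b12' / b11') ^ 4 * Delta b00' b01' b11'"
  by (simp only: ratio_transform[OF assms] Delta_transform power_mult_distrib mult_ac)

text \<open>Sends \<open>e 0\<close> to \<open>a0 *s e 0 + a1 *s e 1\<close> and \<open>e 1\<close>
  to \<open>c1 *s e 1\<close>. The other images are forced by bracketing successively with the image
  of \<open>e 0\<close> on the right; this produces the terms in \<open>b11'\<close> and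
  \<open>b12'\<close>.\<close>

definition iso_map :: "complex ^ 5 \<Rightarrow> complex ^ 5" where
  "iso_map x = (\<chi> i.
     if i = 0 then a0 * x $ 0
     else if i = 1 then a1 * x $ 0 + c1 * x $ 1
     else if i = 2 then a0 * c1 * x $ 2
     else if i = 3 then a0\<^sup>2 * c1 * x $ 3
     else b11' * c1 * a1 * x $ 2 - b12' * a0 * c1 * a1 * x $ 3 + a0 ^ 3 * c1 * x $ 4)"

lemma iso_map_nth:
  "iso_map x $ 0 = a0 * x $ 0"
  "iso_map x $ 1 = a1 * x $ 0 + c1 * x $ 1"
  "iso_map x $ 2 = a0 * c1 * x $ 2"
  "iso_map x $ 3 = a0\<^sup>2 * c1 * x $ 3"
  "iso_map x $ 4 = b11' * c1 * a1 * x $ 2 - b12' * a0 * c1 * a1 * x $ 3 + a0 ^ 3 * c1 * x $ 4"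
  by (simp_all add: iso_map_def)

lemma linear_iso_map: "Vector_Spaces.linear (*s) (*s) iso_map"
  by unfold_locales (simp_all add: vec_eq_iff forall_5 iso_map_nth algebra_simps)

lemma bij_iso_map: "bij iso_map"
proof -
  have "x = y" if "iso_map x = iso_map y" for x y
    using that a0_nz c1_nz by (auto simp: vec_eq_iff forall_5 iso_map_nth)
  then have "inj iso_map" by (rule injI)
  then show ?thesis
    using vec.linear_inj_imp_surj[OF linear_iso_map] by (simp add: bij_def)
qed

lemma iso_map_L:
  "iso_map (L b00 b01 b11 b12 x y) = L b00' b01' b11' b12' (iso_map x) (iso_map y)"
proof -
  \<comment> \<open>Only this coordinate needs the four equations; the others agree
    identically.\<close>
  have "L b00' b01' b11' b12' (iso_map x) (iso_map y) $ 4 =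
      iso_map (L b00 b01 b11 b12 x y) $ 4"
    unfolding L_coordinates iso_map_nth using eq00 eq01 eq11 eq12 by algebra
  then show ?thesis
    by (simp add: vec_eq_iff forall_5 L_coordinates iso_map_nth algebra_simps power2_eq_square)
qed

lemma isomorphic_L: "isomorphic (L b00 b01 b11 b12) (L b00' b01' b11' b12')"
  unfolding isomorphic_def leibniz_isomorphic_def
  using leibniz_algebra_L linear_iso_map bij_iso_map iso_map_L by blast

end

lemma isomorphic_L_imp_change_of_generators:
  assumes "isomorphic (L b00 b01 b11 b12) (L b00' b01' b11' b12')"
  shows "\<exists>a0 a1 c1. change_of_generators b00 b01 b11 b12 b00' b01' b11' b12' a0 a1 c1"
proof -
  let ?L = "L b00 b01 b11 b12" and ?L' = "L b00' b01' b11' b12'"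
  obtain f where lin: "Vector_Spaces.linear (*s) (*s) f" and "bij f"
    and hom: "\<And>x y. f (?L x y) = ?L' (f x) (f y)"
    using assms unfolding isomorphic_def leibniz_isomorphic_def by blast
  interpret f: Vector_Spaces.linear "(*s)" "(*s)" f by (rule lin)
  define a where "a = f (e 0)"
  define c where "c = f (e 1)"
  \<comment> \<open>The determinant of the map that \<open>f\<close> induces on the coordinates 0
    and 1.\<close>
  define d where "d = a $ 0 * c $ 1 - a $ 1 * c $ 0"
  have f2: "f (e 2) = ?L' c a"
    using hom[of "e 1" "e 0"] by (simp add: L_basis basis_bracket_def a_def c_def)
  have f3: "f (e 3) = ?L' (f (e 2)) a"
    using hom[of "e 2" "e 0"] by (simp add: L_basis basis_bracket_def a_def)
  have f4: "f (e 4) = ?L' (f (e 3)) a"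
    using hom[of "e 3" "e 0"] by (simp add: L_basis basis_bracket_def a_def)
  have "f (e 4) \<noteq> 0"
  proof
    assume "f (e 4) = 0"
    then have "f (e 4) = f 0" by (simp add: f.zero)
    then have "e 4 = 0" using \<open>bij f\<close> by (metis bij_is_inj injD)
    then show False using e_nth[of 4 4] by simp
  qed
  have f4_nth: "f (e 4) $ 0 = 0" "f (e 4) $ 1 = 0" "f (e 4) $ 2 = 0" "f (e 4) $ 3 = 0"
    "f (e 4) $ 4 = d * (a $ 0)\<^sup>2"
    by (simp_all add: f4 f3 f2 L_coordinates d_def power2_eq_square algebra_simps)
  with \<open>f (e 4) \<noteq> 0\<close> have "d * (a $ 0)\<^sup>2 \<noteq> 0"
    by (auto simp: vec_eq_iff forall_5)
  then have nz: "d \<noteq> 0" "a $ 0 \<noteq> 0" by auto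
  have br12: "?L' c (f (e 2)) = b12 *s f (e 4)"
    using hom[of "e 1" "e 2"] by (simp add: L_basis basis_bracket_def c_def f.scale)
  \<comment> \<open>The image of \<open>e 4\<close> has no coordinate 3, whereas the bracket of
    \<open>c\<close> with \<open>f (e 2)\<close> has \<open>- (c $ 0 * d)\<close> there.\<close>
  have "- (c $ 0 * d) = 0"
    using arg_cong[OF br12, of "\<lambda>v. v $ 3"]
    by (simp add: f2 f4_nth L_coordinates d_def algebra_simps)
  with nz have c0: "c $ 0 = 0" by simp
  with nz have c1: "c $ 1 \<noteq> 0" by (auto simp: d_def)
  have d_eq: "d = a $ 0 * c $ 1" by (simp add: d_def c0)
  have "b12' * c $ 1 * d = b12 * (d * (a $ 0)\<^sup>2)"
    using arg_cong[OF br12, of "\<lambda>v. v $ 4"]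
    by (simp add: f2 f4_nth L_coordinates c0 d_eq algebra_simps)
  then have eq12: "b12' * c $ 1 = b12 * (a $ 0)\<^sup>2" using nz by simp
  have "?L' c c = b11 *s f (e 4)"
    using hom[of "e 1" "e 1"] by (simp add: L_basis basis_bracket_def c_def f.scale)
  from arg_cong[OF this, of "\<lambda>v. v $ 4"]
  have "c $ 1 * (b11' * c $ 1) = c $ 1 * (b11 * (a $ 0) ^ 3)"
    by (simp add: f4_nth L_coordinates c0 d_eq algebra_simps power2_eq_square power3_eq_cube)
  then have eq11: "b11' * c $ 1 = b11 * (a $ 0) ^ 3" using c1 by simp
  have "?L' a a = b00 *s f (e 4)"
    using hom[of "e 0" "e 0"] by (simp add: L_basis basis_bracket_def a_def f.scale)
  from arg_cong[OF this, of "\<lambda>v. v $ 4"]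
  have eq00: "b00' * (a $ 0)\<^sup>2 + b01' * a $ 0 * a $ 1 + b11' * (a $ 1)\<^sup>2 =
      b00 * c $ 1 * (a $ 0) ^ 3"
    by (simp add: f4_nth L_coordinates d_eq algebra_simps power2_eq_square power3_eq_cube)
  \<comment> \<open>Moving \<open>f (e 2) = ?L' c a\<close> to the left symmetrizes the bracket: the
    antisymmetric terms, with all coordinates 2 and 3 of \<open>a\<close> and \<open>c\<close>,
    cancel, and the \<open>b11'\<close> term doubles.\<close>
  have "?L' a c = - f (e 2) + b01 *s f (e 4)"
    using hom[of "e 0" "e 1"]
    by (simp add: L_basis basis_bracket_def a_def c_def f.scale f.diff)
  from arg_cong[OF this, of "\<lambda>v. v $ 4"]
  have "c $ 1 * (b01' * a $ 0 + 2 * b11' * a $ 1) = c $ 1 * (b01 * (a $ 0) ^ 3)"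
    by (simp add: f2 f4_nth L_coordinates c0 d_eq algebra_simps power2_eq_square power3_eq_cube)
  then have eq01: "b01' * a $ 0 + 2 * b11' * a $ 1 = b01 * (a $ 0) ^ 3" using c1 by simp
  have "change_of_generators b00 b01 b11 b12 b00' b01' b11' b12' (a $ 0) (a $ 1) (c $ 1)"
    using nz(2) c1 eq00 eq01 eq11 eq12 by unfold_locales
  then show ?thesis by blast
qed

text \<open>Here \<open>a0\<close> is forced by \<open>ratio_transform\<close>, while
  \<open>a1\<close> and \<open>c1\<close> solve the linear equations \<open>eq01\<close> and
  \<open>eq11\<close>. The choice of \<open>a0\<close> then yields \<open>eq12\<close>, and equality
  of the invariants yields \<open>eq00\<close>.\<close>

lemma change_of_generators_exists:
  assumes nz: "b11 \<noteq> 0" "b12 \<noteq> 0" "b11' \<noteq> 0" "b12' \<noteq> 0"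
    and inv: "(b12 / b11) ^ 4 * Delta b00 b01 b11 = (b12' / b11') ^ 4 * Delta b00' b01' b11'"
  shows "\<exists>a0 a1 c1. change_of_generators b00 b01 b11 b12 b00' b01' b11' b12' a0 a1 c1"
proof -
  define a0 where "a0 = (b12 / b11) / (b12' / b11')"
  define a1 where "a1 = (b01 * a0 ^ 3 - b01' * a0) / (2 * b11')"
  define c1 where "c1 = b11 * a0 ^ 3 / b11'"
  have a0: "a0 \<noteq> 0" using nz by (simp add: a0_def)
  have c1: "c1 \<noteq> 0" using nz a0 by (simp add: c1_def)
  have eq01: "b01' * a0 + 2 * b11' * a1 = b01 * a0 ^ 3"
    using nz by (simp add: a1_def)
  have eq11: "b11' * c1 = b11 * a0 ^ 3"
    using nz by (simp add: c1_def)
  have "b12' * a0 * b11 = b12 * b11'"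
    using nz by (simp add: a0_def)
  then have "b11' * (b12' * c1) = b11' * (b12 * a0\<^sup>2)"
    using eq11 by algebra
  then have eq12: "b12' * c1 = b12 * a0\<^sup>2" using nz by simp
  have "b12 / b11 = a0 * (b12' / b11')" using nz by (simp add: a0_def)
  then have "(b12' / b11') ^ 4 * (a0 ^ 4 * Delta b00 b01 b11) =
      (b12' / b11') ^ 4 * Delta b00' b01' b11'"
    using inv by (simp only: power_mult_distrib mult_ac)
  then have Delta: "a0 ^ 4 * Delta b00 b01 b11 = Delta b00' b01' b11'"
    using nz by simp
  \<comment> \<open>The square completion of \<open>Delta_transform\<close> read backwards; the
    factor \<open>4 * b11'\<close> is nonzero.\<close>
  have "4 * b11' * (b00' * a0\<^sup>2 + b01' * a0 * a1 + b11' * a1\<^sup>2) =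
      4 * b11' * (b00 * c1 * a0 ^ 3)"
    using Delta eq01 eq11 unfolding Delta_def by algebra
  then have eq00: "b00' * a0\<^sup>2 + b01' * a0 * a1 + b11' * a1\<^sup>2 = b00 * c1 * a0 ^ 3"
    using nz by simp
  have "change_of_generators b00 b01 b11 b12 b00' b01' b11' b12' a0 a1 c1"
    using a0 c1 eq00 eq01 eq11 eq12 by unfold_locales
  then show ?thesis by blast
qed

lemma L_isomorphic_iff:
  assumes "b11 \<noteq> 0" "b12 \<noteq> 0" "b11' \<noteq> 0" "b12' \<noteq> 0"
  shows "isomorphic (L b00 b01 b11 b12) (L b00' b01' b11' b12') \<longleftrightarrow>
    (b12 / b11) ^ 4 * Delta b00 b01 b11 = (b12' / b11') ^ 4 * Delta b00' b01' b11'"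
  using isomorphic_L_imp_change_of_generators change_of_generators_exists[OF assms]
    change_of_generators.invariant_eq[OF _ assms(1,3)] change_of_generators.isomorphic_L
  by metis

text \<open>Membership in \<open>U1\<close> only provides some parameters for the bracket, so
  \<open>b11\<close> and \<open>b12\<close> have to be recovered from the bracket itself.\<close>

lemma L_in_U1_iff: "L b00 b01 b11 b12 \<in> U1 \<longleftrightarrow> b11 \<noteq> 0 \<and> b12 \<noteq> 0"
proof
  assume "L b00 b01 b11 b12 \<in> U1"
  then obtain p q r s where eq: "L b00 b01 b11 b12 = L p q r s" and "r \<noteq> 0" "s \<noteq> 0"
    unfolding U1_def by auto
  have "L b00 b01 b11 b12 (e 1) (e 1) $ 4 = b11" "L p q r s (e 1) (e 1) $ 4 = r"
    "L b00 b01 b11 b12 (e 1) (e 2) $ 4 = b12" "L p q r s (e 1) (e 2) $ 4 = s"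
    by (simp_all add: L_basis basis_bracket_def e_nth)
  with eq \<open>r \<noteq> 0\<close> \<open>s \<noteq> 0\<close> show "b11 \<noteq> 0 \<and> b12 \<noteq> 0" by simp
next
  assume "b11 \<noteq> 0 \<and> b12 \<noteq> 0"
  then show "L b00 b01 b11 b12 \<in> U1" unfolding U1_def CE_mu4_def by blast
qed

theorem proposition3p4:
  shows "(\<forall>b00 b01 b11 b12 b00' b01' b11' b12'.
            L b00 b01 b11 b12 \<in> U1 \<longrightarrow> L b00' b01' b11' b12' \<in> U1 \<longrightarrow>
            (isomorphic (L b00 b01 b11 b12) (L b00' b01' b11' b12') \<longleftrightarrow>
             (b12 / b11) ^ 4 * Delta b00 b01 b11 = (b12' / b11') ^ 4 * Delta b00' b01' b11'))
       \<and> (\<forall>z. \<exists>b00 b01 b11 b12. L b00 b01 b11 b12 \<in> U1 \<and>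
            (b12 / b11) ^ 4 * Delta b00 b01 b11 = z)
       \<and> (\<forall>A\<in>U1. \<exists>z. isomorphic A (L z 0 1 1))"
proof (intro conjI allI impI ballI)
  fix b00 b01 b11 b12 b00' b01' b11' b12'
  assume "L b00 b01 b11 b12 \<in> U1" "L b00' b01' b11' b12' \<in> U1"
  then show "isomorphic (L b00 b01 b11 b12) (L b00' b01' b11' b12') \<longleftrightarrow>
      (b12 / b11) ^ 4 * Delta b00 b01 b11 = (b12' / b11') ^ 4 * Delta b00' b01' b11'"
    unfolding L_in_U1_iff by (intro L_isomorphic_iff) simp_all
next
  fix z
  \<comment> \<open>The invariant of \<open>L w 0 1 1\<close> is \<open>- 4 * w\<close>, hence the
    division by -4, here and for the normal form of \<open>A\<close> below.\<close>
  have "L (- z / 4) 0 1 1 \<in> U1" "(1 / 1) ^ 4 * Delta (- z / 4) 0 1 = z"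
    by (simp_all add: L_in_U1_iff Delta_def)
  then show "\<exists>b00 b01 b11 b12. L b00 b01 b11 b12 \<in> U1 \<and>
      (b12 / b11) ^ 4 * Delta b00 b01 b11 = z"
    by blast
next
  fix A assume "A \<in> U1"
  then obtain b00 b01 b11 b12 where A: "A = L b00 b01 b11 b12" "b11 \<noteq> 0" "b12 \<noteq> 0"
    unfolding U1_def by blast
  have "isomorphic A (L (- ((b12 / b11) ^ 4 * Delta b00 b01 b11) / 4) 0 1 1)"
    using A by (simp add: L_isomorphic_iff) (simp add: Delta_def)
  then show "\<exists>z. isomorphic A (L z 0 1 1)" by blast
qed

end
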